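(* Fix an Arctic auction with stepwise marginal costs. If a good is sold in positive quantity in two competitive equilibria, then its price is the same in both equilibria. In particular, any two competitive equilibria in which every good is sold in positive quantity have the same price vector.
   Context: Arctic auction with stepwise marginal costs. There are goods $[n]=\{1,\dots,n\}$ and bids $(\beta^j;\mathbf r^j)$, $j\in[m]$, with budget $\beta^j\in\mathbb R_{\ge 0}$ and value vector $\mathbf r^j\in\mathbb R^n_{\ge 0}$. At prices $\mathbf p\in\mathbb R^n_{>0}$, the demand of bid $j$ is $D^j(\mathbf p)=\operatorname{argmax}\{(\mathbf r^j-\mathbf p)\cdot\mathbf x : \mathbf x\in\mathbb R^n_{\ge 0},\ \mathbf p\cdot\mathbf x\le\beta^j\}$. The auctioneer has cost $C(\mathbf y)=\sum_{i\in[n]}C_i(y_i)$, where $C_i$ has $K_i\ge 1$ steps; step $k\in[K_i]$ has width $s_{ik}>0$ and marginal cost $c_{ik}$, with $0\le c_{i1}<c_{i2}<\dots<c_{iK_i}$. With $S_{i0}=0$, $S_{ik}=\sum_{h=1}^k s_{ih}$ and $s_i=S_{iK_i}$ (the supply cap), $C_i(y_i)=\sum_{k<l}c_{ik}s_{ik}+c_{il}(y_i-S_{i,l-1})$ for $y_i\in[S_{i,l-1},S_{il}]$, and $C_i(y_i)=\infty$ for $y_i>s_i$. A competitive equilibrium consists of prices $\mathbf p\in\mathbb R^n_{>0}$ and allocations $\mathbf x^1,\dots,\mathbf x^m$ with $\mathbf x^j\in D^j(\mathbf p)$ for all $j$ and $\mathbf y=\sum_j\mathbf x^j\in\operatorname{argmax}_{\mathbf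 z\in\mathbb R^n_{\ge 0}}\{\mathbf p\cdot\mathbf z-C(\mathbf z)\}$. Good $i$ is sold in positive quantity in this equilibrium if $y_i>0$. Standing assumption: every bid has positive value for at least one good, and for every good $i$ there is a bid $j$ with $\beta^j>0$ and $r^j_i>0$. *)

theory Defs
  imports "HOL-Analysis.Analysis"
begin

text \<open>Steps of good \<open>i\<close> are numbered \<open>1, \<dots>, nsteps i\<close>; the values of \<open>width i\<close> and \<open>mcost i\<close>
  at other indices are irrelevant.\<close>

record ('m, 'n) arctic_auction =
  budget :: "'m \<Rightarrow> real"
  val :: "'m \<Rightarrow> real ^ 'n"
  nsteps :: "'n \<Rightarrow> nat"
  width :: "'n \<Rightarrow> nat \<Rightarrow> real"
  mcost :: "'n \<Rightarrow> nat \<Rightarrow> real"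

text \<open>The last two conjuncts are the standing non-degeneracy assumption on the bids.\<close>

definition arctic_auction :: "('m::finite, 'n::finite) arctic_auction \<Rightarrow> bool" where
  "arctic_auction A \<longleftrightarrow>
     (\<forall>j. 0 \<le> budget A j) \<and>
     (\<forall>j i. 0 \<le> val A j $ i) \<and>
     (\<forall>i. 1 \<le> nsteps A i) \<and>
     (\<forall>i. \<forall>k\<in>{1..nsteps A i}. 0 < width A i k) \<and>
     (\<forall>i. 0 \<le> mcost A i 1) \<and>
     (\<forall>i. strict_mono_on {1..nsteps A i} (mcost A i)) \<and>
     (\<forall>j. \<exists>i. 0 < val A j $ i) \<and>
     (\<forall>i. \<exists>j. 0 < budget A j \<and> 0 < val A j $ i)"

definition nonneg_vec :: "real ^ 'n::finite \<Rightarrow> bool" where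
  "nonneg_vec x \<longleftrightarrow> (\<forall>i. 0 \<le> x $ i)"

definition pos_vec :: "real ^ 'n::finite \<Rightarrow> bool" where
  "pos_vec x \<longleftrightarrow> (\<forall>i. 0 < x $ i)"

definition demand ::
  "('m::finite, 'n::finite) arctic_auction \<Rightarrow> 'm \<Rightarrow> real ^ 'n \<Rightarrow> (real ^ 'n) set" where
  "demand A j p =
     {x. is_arg_max (\<lambda>x. (val A j - p) \<bullet> x) (\<lambda>x. nonneg_vec x \<and> p \<bullet> x \<le> budget A j) x}"

definition cum_width :: "('m::finite, 'n::finite) arctic_auction \<Rightarrow> 'n \<Rightarrow> nat \<Rightarrow> real" where
  "cum_width A i k = (\<Sum>h=1..k. width A i h)"

definition supply_cap :: "('m::finite, 'n::finite) arctic_auction \<Rightarrow> 'n \<Rightarrow> real" where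
  "supply_cap A i = cum_width A i (nsteps A i)"

text \<open>Only arguments \<open>y \<ge> 0\<close> matter. At a breakpoint two steps qualify, and the least is taken;
  lemma \<open>good_cost_eq\<close> shows that either choice gives the same cost.\<close>

definition good_cost ::
  "('m::finite, 'n::finite) arctic_auction \<Rightarrow> 'n \<Rightarrow> real \<Rightarrow> ereal" where
  "good_cost A i y =
     (if y > supply_cap A i then \<infinity>
      else let l = (LEAST l. 1 \<le> l \<and> y \<le> cum_width A i l)
           in ereal ((\<Sum>k=1..<l. mcost A i k * width A i k)
                     + mcost A i l * (y - cum_width A i (l - 1))))"

definition total_cost ::
  "('m::finite, 'n::finite) arctic_auction \<Rightarrow> real ^ 'n \<Rightarrow> ereal" where
  "total_cost A y = (\<Sum>i\<in>UNIV. good_cost A i (y $ i))"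

definition competitive_equilibrium ::
  "('m::finite, 'n::finite) arctic_auction \<Rightarrow> real ^ 'n \<Rightarrow> ('m \<Rightarrow> real ^ 'n) \<Rightarrow> bool" where
  "competitive_equilibrium A p x \<longleftrightarrow>
     pos_vec p \<and>
     (\<forall>j. x j \<in> demand A j p) \<and>
     is_arg_max (\<lambda>z. ereal (p \<bullet> z) - total_cost A z) nonneg_vec (\<Sum>j\<in>UNIV. x j)"

definition sold_positive :: "('m::finite \<Rightarrow> real ^ 'n::finite) \<Rightarrow> 'n \<Rightarrow> bool" where
  "sold_positive x i \<longleftrightarrow> 0 < (\<Sum>j\<in>UNIV. x j) $ i"

lemma cum_width_strict_mono:
  assumes "arctic_auction A" "a < b" "b \<le> nsteps A i"
  shows "cum_width A i a < cum_width A i b"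
proof -
  have "{1..b} = {1..a} \<union> {Suc a..b}" "{1..a} \<inter> {Suc a..b} = {}"
    using assms(2) by auto
  then have "cum_width A i b = cum_width A i a + (\<Sum>h=Suc a..b. width A i h)"
    unfolding cum_width_def by (simp add: sum.union_disjoint)
  moreover have "0 < (\<Sum>h=Suc a..b. width A i h)"
    using assms by (intro sum_pos) (auto simp: arctic_auction_def)
  ultimately show ?thesis by simp
qed

lemma good_cost_eq:
  assumes A: "arctic_auction A" and l: "1 \<le> l" "l \<le> nsteps A i"
    and y: "cum_width A i (l - 1) \<le> y" "y \<le> cum_width A i l" "0 \<le> y"
  shows "good_cost A i y =
    ereal ((\<Sum>k=1..<l. mcost A i k * width A i k) + mcost A i l * (y - cum_width A i (l - 1)))"
proof -
  define l0 where "l0 = (LEAST l. 1 \<le> l \<and> y \<le> cum_width A i l)"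
  have l0: "1 \<le> l0" "y \<le> cum_width A i l0" "l0 \<le> l"
    using LeastI[of "\<lambda>l. 1 \<le> l \<and> y \<le> cum_width A i l" l] l y
      Least_le[of "\<lambda>l. 1 \<le> l \<and> y \<le> cum_width A i l" l]
    unfolding l0_def by auto
  have mono: "cum_width A i a \<le> cum_width A i b" if "a \<le> b" "b \<le> nsteps A i" for a b
    using cum_width_strict_mono[OF A, of a b i] that by (cases "a = b") auto
  have cap: "\<not> y > supply_cap A i"
    using mono[of l "nsteps A i"] l y by (simp add: supply_cap_def)
  have gc: "good_cost A i y =
    ereal ((\<Sum>k=1..<l0. mcost A i k * width A i k) + mcost A i l0 * (y - cum_width A i (l0 - 1)))"
    using cap by (simp add: good_cost_def l0_def Let_def)
  show ?thesis
  proof (cases "l0 = l")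
    case True
    then show ?thesis using gc by simp
  next
    case False
    then have "l0 \<le> l - 1" using l0 by auto
    have "\<not> l0 < l - 1"
      using cum_width_strict_mono[OF A, of l0 "l - 1" i] l l0 y by linarith
    then have e: "l = Suc l0" using \<open>l0 \<le> l - 1\<close> l by auto
    then have yl: "y = cum_width A i l0" using l0 y by auto
    obtain q where q: "l0 = Suc q" using l0 by (cases l0) auto
    have "cum_width A i l0 - cum_width A i (l0 - 1) = width A i l0"
      by (simp add: cum_width_def q)
    then show ?thesis using gc yl e q by (simp add: algebra_simps)
  qed
qed

end

theory Submission
  imports Defs
begin

text \<open>
  Let \<open>b j i = p i * x j i\<close> be the amount bid \<open>j\<close> spends on good \<open>i\<close>. The demand of a bid
  maximises not only its utility but also \<open>\<Sum>i. b j i * ln (r j i / p i)\<close> over all spending vectors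
  within the budget, since both problems spend only on goods of largest value-price ratio, and only
  if this ratio is at least \<open>1\<close>. As this objective is linear in \<open>ln p\<close>, aggregate spending is
  antitone in \<open>ln p\<close>: \<open>\<Sum>i. (ln (p i) - ln (p' i)) * (q i - q' i) \<le> 0\<close> for two equilibria.
  On the supply side, quantities \<open>y i\<close> are monotone in prices, so \<open>q i = p i * y i\<close> is monotone too,
  and strictly so for goods that are sold. Hence every summand is nonnegative, so all vanish,
  and the price of a sold good cannot differ.
\<close>

lemma inner_vec_real: "(x :: real ^ 'n::finite) \<bullet> y = (\<Sum>i\<in>UNIV. x $ i * y $ i)"
  by (simp add: inner_vec_def)

section \<open>Demand side: multipliers and antitone spending\<close>

lemma demand_feasible:
  assumes "x \<in> demand A j p"
  shows "0 \<le> x $ i" "p \<bullet> x \<le> budget A j"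
  using assms by (auto simp: demand_def is_arg_max_def nonneg_vec_def)

text \<open>Linear programming duality for a single bid: \<open>\<mu> - 1\<close> is an optimal dual
  variable of the budget constraint, and the last two claims are complementary slackness. The lower
  bound \<open>1\<close> on \<open>\<mu>\<close> is the ratio earned by money that is kept.\<close>

lemma demand_multiplier:
  fixes A :: "('m::finite, 'n::finite) arctic_auction"
  assumes A: "arctic_auction A" and p: "pos_vec p" and x: "x \<in> demand A j p"
  shows "\<exists>\<mu>\<ge>1. (\<forall>i. val A j $ i \<le> \<mu> * p $ i) \<and>
    (\<forall>i. 0 < x $ i \<longrightarrow> val A j $ i = \<mu> * p $ i) \<and> (\<mu> = 1 \<or> p \<bullet> x = budget A j)"
proof -
  define r where "r = val A j"
  define \<beta> where "\<beta> = budget A j"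
  define \<mu> where "\<mu> = max 1 (Max (range (\<lambda>i. r $ i / p $ i)))"
  have pp: "0 < p $ i" for i using p by (simp add: pos_vec_def)
  have \<beta>: "0 \<le> \<beta>" using A by (simp add: \<beta>_def arctic_auction_def)
  have \<mu>1: "1 \<le> \<mu>" by (simp add: \<mu>_def)
  have "r $ i / p $ i \<le> \<mu>" for i
    unfolding \<mu>_def by (rule max.coboundedI2) (rule Max_ge, auto)
  then have r_le: "r $ i \<le> \<mu> * p $ i" for i
    using pp[of i] by (simp add: divide_simps)
  have xnn: "0 \<le> x $ i" for i by (rule demand_feasible(1)[OF x])
  have xb: "p \<bullet> x \<le> \<beta>" unfolding \<beta>_def by (rule demand_feasible(2)[OF x])
  have opt: "(r - p) \<bullet> z \<le> (r - p) \<bullet> x" if "nonneg_vec z" "p \<bullet> z \<le> \<beta>" for z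
    using x that unfolding demand_def is_arg_max_linorder r_def \<beta>_def by auto
  \<comment> \<open>The dual value is attained: by the zero bundle if \<open>\<mu> = 1\<close>, and
    otherwise by spending the whole budget on one good \<open>k\<close> of maximal value-price
    ratio.\<close>
  have val_ge: "(\<mu> - 1) * \<beta> \<le> (r - p) \<bullet> x"
  proof (cases "\<mu> = 1")
    case True
    then show ?thesis using opt[of 0] \<beta> by (simp add: nonneg_vec_def)
  next
    case False
    have "Max (range (\<lambda>i. r $ i / p $ i)) \<in> range (\<lambda>i. r $ i / p $ i)"
      by (rule Max_in) auto
    then obtain k where "Max (range (\<lambda>i. r $ i / p $ i)) = r $ k / p $ k" by (rule imageE)
    with False have k: "\<mu> = r $ k / p $ k" unfolding \<mu>_def by (simp add: max_def split: if_splits)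
    define z where "z = axis k (\<beta> / p $ k)"
    have "nonneg_vec z" using \<beta> pp[of k] by (simp add: z_def nonneg_vec_def axis_def)
    moreover have "p \<bullet> z = \<beta>" using pp[of k] by (simp add: z_def inner_axis)
    moreover have "(r - p) \<bullet> z = (\<mu> - 1) * \<beta>"
      using pp[of k] by (simp add: z_def inner_axis k field_simps)
    ultimately show ?thesis using opt[of z] by simp
  qed
  have slack: "0 \<le> (\<mu> * p $ i - r $ i) * x $ i" for i
    using r_le[of i] xnn[of i] by simp
  have "(\<Sum>i\<in>UNIV. (\<mu> * p $ i - r $ i) * x $ i) = \<mu> * (p \<bullet> x) - r \<bullet> x"
    by (simp add: inner_vec_real left_diff_distrib sum_subtractf sum_distrib_left mult.assoc)
  \<comment> \<open>The left-hand side is the duality gap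
    \<open>(\<mu> - 1) * \<beta> - (r - p) \<bullet> x\<close>, split into two nonnegative slack
    terms; both must therefore vanish.\<close>
  then have "(\<Sum>i\<in>UNIV. (\<mu> * p $ i - r $ i) * x $ i) + (\<mu> - 1) * (\<beta> - p \<bullet> x) \<le> 0"
    using val_ge by (simp add: algebra_simps inner_diff_left)
  moreover have "0 \<le> (\<Sum>i\<in>UNIV. (\<mu> * p $ i - r $ i) * x $ i)"
    using slack by (intro sum_nonneg) auto
  moreover have "0 \<le> (\<mu> - 1) * (\<beta> - p \<bullet> x)" using \<mu>1 xb by simp
  ultimately have s0: "(\<Sum>i\<in>UNIV. (\<mu> * p $ i - r $ i) * x $ i) = 0"
    and b0: "(\<mu> - 1) * (\<beta> - p \<bullet> x) = 0" by linarith+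
  have "(\<mu> * p $ i - r $ i) * x $ i = 0" for i
    using s0 slack by (simp add: sum_nonneg_eq_0_iff)
  then have r_eq: "r $ i = \<mu> * p $ i" if "0 < x $ i" for i
    using that by (metis eq_iff_diff_eq_0 mult_eq_0_iff less_irrefl)
  show ?thesis
  proof (intro exI[of _ \<mu>] conjI allI impI)
    show "1 \<le> \<mu>" by (rule \<mu>1)
    show "val A j $ i \<le> \<mu> * p $ i" for i using r_le[of i] by (simp add: r_def)
    show "val A j $ i = \<mu> * p $ i" if "0 < x $ i" for i using r_eq[OF that] by (simp add: r_def)
    show "\<mu> = 1 \<or> p \<bullet> x = budget A j" using b0 by (auto simp: \<beta>_def)
  qed
qed

text \<open>Wherever \<open>val A j $ i = 0\<close>, both demands vanish, so the junk value \<open>ln 0 = 0\<close> is harmless.\<close>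

lemma demand_maximizes_log_spending:
  fixes A :: "('m::finite, 'n::finite) arctic_auction"
  assumes A: "arctic_auction A" and p: "pos_vec p" and p': "pos_vec p'"
    and x: "x \<in> demand A j p" and x': "x' \<in> demand A j p'"
  shows "(\<Sum>i\<in>UNIV. p' $ i * x' $ i * (ln (val A j $ i) - ln (p $ i)))
    \<le> (\<Sum>i\<in>UNIV. p $ i * x $ i * (ln (val A j $ i) - ln (p $ i)))"
proof -
  obtain \<mu> where \<mu>: "1 \<le> \<mu>" "\<And>i. val A j $ i \<le> \<mu> * p $ i"
    "\<And>i. 0 < x $ i \<Longrightarrow> val A j $ i = \<mu> * p $ i" "\<mu> = 1 \<or> p \<bullet> x = budget A j"
    using demand_multiplier[OF A p x] by metis
  obtain \<mu>' where \<mu>': "1 \<le> \<mu>'" "\<And>i. 0 < x' $ i \<Longrightarrow> val A j $ i = \<mu>' * p' $ i"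
    using demand_multiplier[OF A p' x'] by metis
  have pp: "0 < p $ i" "0 < p' $ i" for i using p p' by (auto simp: pos_vec_def)
  \<comment> \<open>At prices \<open>p\<close>, a unit of money spent on any good of positive value
    earns at most \<open>ln \<mu>\<close>. The multiplier \<open>\<mu>'\<close> serves to show that
    \<open>x'\<close> contains only such goods.\<close>
  have le: "p' $ i * x' $ i * (ln (val A j $ i) - ln (p $ i)) \<le> ln \<mu> * (p' $ i * x' $ i)" for i
  proof (cases "0 < x' $ i")
    case True
    then have "0 < val A j $ i" using \<mu>' pp[of i] by simp
    then have "ln (val A j $ i) \<le> ln (\<mu> * p $ i)" using \<mu>(2)[of i] by simp
    then have "ln (val A j $ i) - ln (p $ i) \<le> ln \<mu>" using \<mu>(1) pp[of i] by (simp add: ln_mult)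
    then have "(p' $ i * x' $ i) * (ln (val A j $ i) - ln (p $ i)) \<le> (p' $ i * x' $ i) * ln \<mu>"
      using True pp[of i] by (intro mult_left_mono) auto
    then show ?thesis by (simp add: mult.commute)
  next
    case False
    then show ?thesis using demand_feasible(1)[OF x', of i] by simp
  qed
  have eq: "p $ i * x $ i * (ln (val A j $ i) - ln (p $ i)) = ln \<mu> * (p $ i * x $ i)" for i
  proof (cases "0 < x $ i")
    case True
    then show ?thesis using \<mu>(1,3) pp[of i] by (simp add: ln_mult)
  next
    case False
    then show ?thesis using demand_feasible(1)[OF x, of i] by simp
  qed
  have "(\<Sum>i\<in>UNIV. p' $ i * x' $ i * (ln (val A j $ i) - ln (p $ i))) \<le> ln \<mu> * (p' \<bullet> x')"
    using le by (simp add: inner_vec_real sum_distrib_left sum_mono)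
  also have "\<dots> \<le> ln \<mu> * budget A j"
    using demand_feasible(2)[OF x'] \<mu>(1) by (intro mult_left_mono) auto
  \<comment> \<open>Either the budget is exhausted, or \<open>\<mu> = 1\<close> and both sides are
    zero.\<close>
  also have "\<dots> = ln \<mu> * (p \<bullet> x)" using \<mu>(4) by auto
  also have "\<dots> = (\<Sum>i\<in>UNIV. p $ i * x $ i * (ln (val A j $ i) - ln (p $ i)))"
    by (simp add: eq inner_vec_real sum_distrib_left)
  finally show ?thesis .
qed

lemma demand_spending_antitone:
  fixes A :: "('m::finite, 'n::finite) arctic_auction"
  assumes A: "arctic_auction A" and p: "pos_vec p" and p': "pos_vec p'"
    and x: "x \<in> demand A j p" and x': "x' \<in> demand A j p'"
  shows "(\<Sum>i\<in>UNIV. (ln (p $ i) - ln (p' $ i)) * (p $ i * x $ i - p' $ i * x' $ i)) \<le> 0"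
proof -
  \<comment> \<open>\<open>W q b u\<close> is the logarithmic objective at prices \<open>q\<close>
    of the spending that buys \<open>u\<close> at prices \<open>b\<close>. Adding the two optimality
    inequalities cancels the terms in \<open>ln (val A j $ i)\<close>.\<close>
  define W where "W q b u = (\<Sum>i\<in>UNIV. b $ i * u $ i * (ln (val A j $ i) - ln (q $ i)))"
    for q b u :: "real ^ 'n"
  have "(\<Sum>i\<in>UNIV. (ln (p $ i) - ln (p' $ i)) * (p $ i * x $ i - p' $ i * x' $ i))
    = (W p p' x' - W p p x) + (W p' p x - W p' p' x')"
    unfolding W_def sum_subtractf[symmetric] sum.distrib[symmetric]
    by (rule sum.cong) (auto simp: algebra_simps)
  also have "\<dots> \<le> 0"
    using demand_maximizes_log_spending[OF A p p' x x'] demand_maximizes_log_spending[OF A p' p x' x]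
    unfolding W_def by linarith
  finally show ?thesis .
qed

section \<open>Supply side: monotone quantities and revenues\<close>

lemma good_cost_neq_MInf: "good_cost A i y \<noteq> - \<infinity>"
  by (simp add: good_cost_def Let_def)

lemma good_cost_zero_finite:
  assumes "arctic_auction A"
  shows "good_cost A i 0 \<noteq> \<infinity>"
proof -
  have "0 \<le> supply_cap A i"
    using assms unfolding supply_cap_def cum_width_def
    by (intro sum_nonneg) (auto simp: arctic_auction_def less_imp_le)
  then show ?thesis by (simp add: good_cost_def Let_def)
qed

text \<open>Producing nothing has finite cost, so a maximiser cannot have profit
  \<open>-\<infinity>\<close>. This allows the supply comparisons to be made in the reals.\<close>

lemma supply_finite_cost:
  fixes A :: "('m::finite, 'n::finite) arctic_auction"
  assumes A: "arctic_auction A"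
    and y: "is_arg_max (\<lambda>z. ereal (p \<bullet> z) - total_cost A z) nonneg_vec y"
  shows "good_cost A i (y $ i) \<noteq> \<infinity>"
proof
  assume inf: "good_cost A i (y $ i) = \<infinity>"
  have "total_cost A y = \<infinity>"
    unfolding total_cost_def using inf by (subst sum_Pinfty) auto
  moreover have "total_cost A 0 \<noteq> \<infinity>"
    unfolding total_cost_def using good_cost_zero_finite[OF A] by (subst sum_Pinfty) auto
  moreover have "nonneg_vec (0 :: real ^ 'n)" by (simp add: nonneg_vec_def)
  ultimately show False
    using y unfolding is_arg_max_def
    by (cases "total_cost A 0") (auto dest!: spec[of _ 0])
qed

text \<open>Profit is separable across goods: changing only coordinate \<open>i\<close> of
  \<open>y\<close> to \<open>t\<close> leaves all other summands fixed. Both costs are finite, so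
  \<open>real_of_ereal\<close> loses nothing.\<close>

lemma supply_coordinate_optimal:
  fixes A :: "('m::finite, 'n::finite) arctic_auction"
  assumes A: "arctic_auction A"
    and y: "is_arg_max (\<lambda>z. ereal (p \<bullet> z) - total_cost A z) nonneg_vec y"
    and t: "0 \<le> t" "good_cost A i t \<noteq> \<infinity>"
  shows "p $ i * t - real_of_ereal (good_cost A i t)
    \<le> p $ i * y $ i - real_of_ereal (good_cost A i (y $ i))"
proof -
  define z where "z = (\<chi> k. if k = i then t else y $ k)"
  define c where "c u k = real_of_ereal (good_cost A k (u $ k))" for u :: "real ^ 'n" and k
  have total: "total_cost A u = ereal (\<Sum>k\<in>UNIV. c u k)"
    if "\<And>k. good_cost A k (u $ k) \<noteq> \<infinity>" for u
  proof -
    have "good_cost A k (u $ k) = ereal (c u k)" for k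
      using that[of k] good_cost_neq_MInf[of A k "u $ k"] by (cases "good_cost A k (u $ k)") (auto simp: c_def)
    then show ?thesis by (simp add: total_cost_def)
  qed
  have fy: "good_cost A k (y $ k) \<noteq> \<infinity>" for k by (rule supply_finite_cost[OF A y])
  have fz: "good_cost A k (z $ k) \<noteq> \<infinity>" for k using fy t by (simp add: z_def)
  have "nonneg_vec z" using y t by (auto simp: is_arg_max_def nonneg_vec_def z_def)
  then have "p \<bullet> z - (\<Sum>k\<in>UNIV. c z k) \<le> p \<bullet> y - (\<Sum>k\<in>UNIV. c y k)"
    using y unfolding is_arg_max_linorder by (auto simp: total[OF fy] total[OF fz])
  then have "(\<Sum>k\<in>UNIV. p $ k * z $ k - c z k) \<le> (\<Sum>k\<in>UNIV. p $ k * y $ k - c y k)"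
    by (simp add: inner_vec_real sum_subtractf)
  moreover have "(\<Sum>k\<in>UNIV - {i}. p $ k * z $ k - c z k) = (\<Sum>k\<in>UNIV - {i}. p $ k * y $ k - c y k)"
    by (intro sum.cong) (auto simp: z_def c_def)
  ultimately have "p $ i * z $ i - c z i \<le> p $ i * y $ i - c y i"
    by (simp add: sum.remove[of UNIV i])
  then show ?thesis by (simp add: z_def c_def)
qed

text \<open>Revealed preference: each of \<open>y $ i\<close> and \<open>y' $ i\<close> is tested
  against the other at its own price, and the costs cancel when the two inequalities are
  added.\<close>

lemma supply_monotone:
  fixes A :: "('m::finite, 'n::finite) arctic_auction"
  assumes A: "arctic_auction A"
    and y: "is_arg_max (\<lambda>z. ereal (p \<bullet> z) - total_cost A z) nonneg_vec y"
    and y': "is_arg_max (\<lambda>z. ereal (p' \<bullet> z) - total_cost A z) nonneg_vec y'"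
    and less: "p $ i < p' $ i"
  shows "y $ i \<le> y' $ i"
proof -
  have "0 \<le> y $ i" "0 \<le> y' $ i" using y y' by (auto simp: is_arg_max_def nonneg_vec_def)
  then have "0 \<le> (p' $ i - p $ i) * (y' $ i - y $ i)"
    using supply_coordinate_optimal[OF A y _ supply_finite_cost[OF A y'], of i]
      supply_coordinate_optimal[OF A y' _ supply_finite_cost[OF A y], of i]
    by (simp add: algebra_simps)
  then show ?thesis using less by (simp add: zero_le_mult_iff)
qed

lemma supply_revenue_strict_mono:
  fixes A :: "('m::finite, 'n::finite) arctic_auction"
  assumes A: "arctic_auction A" and p: "pos_vec p"
    and y: "is_arg_max (\<lambda>z. ereal (p \<bullet> z) - total_cost A z) nonneg_vec y"
    and y': "is_arg_max (\<lambda>z. ereal (p' \<bullet> z) - total_cost A z) nonneg_vec y'"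
    and less: "p $ i < p' $ i"
  shows "p $ i * y $ i \<le> p' $ i * y' $ i" and "0 < y' $ i \<Longrightarrow> p $ i * y $ i < p' $ i * y' $ i"
proof -
  have "p $ i * y $ i \<le> p $ i * y' $ i"
    using supply_monotone[OF A y y' less] p by (intro mult_left_mono) (auto simp: pos_vec_def less_imp_le)
  moreover have "0 \<le> y' $ i" using y' by (auto simp: is_arg_max_def nonneg_vec_def)
  ultimately show "p $ i * y $ i \<le> p' $ i * y' $ i"
    and "0 < y' $ i \<Longrightarrow> p $ i * y $ i < p' $ i * y' $ i"
    using less by (smt (verit) mult_right_mono mult_strict_right_mono)+
qed

section \<open>Comparison of two equilibria\<close>

lemma equilibrium_price_unique:
  fixes A :: "('m::finite, 'n::finite) arctic_auction"
  assumes A: "arctic_auction A"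
    and eq: "competitive_equilibrium A p x" and eq': "competitive_equilibrium A p' x'"
    and sold: "sold_positive x i" and sold': "sold_positive x' i"
  shows "p $ i = p' $ i"
proof -
  define y where "y = (\<Sum>j\<in>UNIV. x j)"
  define y' where "y' = (\<Sum>j\<in>UNIV. x' j)"
  define d where "d k = (ln (p $ k) - ln (p' $ k)) * (p $ k * y $ k - p' $ k * y' $ k)" for k
  have p: "pos_vec p" and p': "pos_vec p'" using eq eq' by (auto simp: competitive_equilibrium_def)
  have pp: "0 < p $ k" "0 < p' $ k" for k using p p' by (auto simp: pos_vec_def)
  have y: "is_arg_max (\<lambda>z. ereal (p \<bullet> z) - total_cost A z) nonneg_vec y"
    and y': "is_arg_max (\<lambda>z. ereal (p' \<bullet> z) - total_cost A z) nonneg_vec y'"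
    using eq eq' by (auto simp: competitive_equilibrium_def y_def y'_def)
  note mono = supply_revenue_strict_mono[OF A p y y'] supply_revenue_strict_mono[OF A p' y' y]
  have "(\<Sum>k\<in>UNIV. d k) = (\<Sum>k\<in>UNIV. \<Sum>j\<in>UNIV.
      (ln (p $ k) - ln (p' $ k)) * (p $ k * x j $ k - p' $ k * x' j $ k))"
    by (simp add: d_def y_def y'_def sum_distrib_left sum_subtractf right_diff_distrib)
  \<comment> \<open>Summing over goods first isolates each bid, whose contribution is
    nonpositive.\<close>
  also have "\<dots> = (\<Sum>j\<in>UNIV. \<Sum>k\<in>UNIV.
      (ln (p $ k) - ln (p' $ k)) * (p $ k * x j $ k - p' $ k * x' j $ k))"
    by (rule sum.swap)
  also have "\<dots> \<le> 0"
    using eq eq' by (intro sum_nonpos demand_spending_antitone[OF A p p'])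
      (auto simp: competitive_equilibrium_def)
  finally have "(\<Sum>k\<in>UNIV. d k) \<le> 0" .
  \<comment> \<open>Whichever price is higher, log price and revenue differ in the same
    direction.\<close>
  moreover have d_nonneg: "0 \<le> d k" for k
    using mono(1,3)[of k] pp[of k] unfolding d_def zero_le_mult_iff
    by (cases "p $ k" "p' $ k" rule: linorder_cases) auto
  ultimately have "(\<Sum>k\<in>UNIV. d k) = 0" by (simp add: order_antisym sum_nonneg)
  then have d0: "d i = 0" using d_nonneg by (simp add: sum_nonneg_eq_0_iff)
  have "0 < y $ i" "0 < y' $ i" using sold sold' by (auto simp: sold_positive_def y_def y'_def)
  \<comment> \<open>If the prices differed, both factors of \<open>d i\<close> would be nonzero.
    Strictness of revenue requires a sale at the higher price; either price could be the higher one,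
    so both sale hypotheses enter.\<close>
  then show ?thesis
    using mono(2,4)[of i] d0 pp[of i] unfolding d_def
    by (cases "p $ i" "p' $ i" rule: linorder_cases) auto
qed

theorem proposition2:
  fixes A :: "('m::finite, 'n::finite) arctic_auction"
  assumes "arctic_auction A"
  shows "(\<forall>p x p' x' i.
            competitive_equilibrium A p x \<and> competitive_equilibrium A p' x' \<and>
            sold_positive x i \<and> sold_positive x' i
            \<longrightarrow> p $ i = p' $ i)
       \<and> (\<forall>p x p' x'.
            competitive_equilibrium A p x \<and> competitive_equilibrium A p' x' \<and>
            (\<forall>i. sold_positive x i) \<and> (\<forall>i. sold_positive x' i)
            \<longrightarrow> p = p')"
  unfolding vec_eq_iff by (blast intro: equilibrium_price_unique[OF assms])

end
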